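(* Let $k \geqslant 5$ be a natural number and let $G$ be a $3$-connected graph with $v(G) \geqslant k + 3$ and $\delta(G) \geqslant \left\lfloor \frac{2k+1}{3} \right\rfloor + 2$. Then $G$ has a $k$-contractible set, i.e. a set $R \subset V(G)$ with $|R| = k$ such that the induced subgraph $G(R)$ is connected and $G - R$ is $2$-connected.
   Context: Graphs are finite, undirected, without loops or multiple edges. $v(G)$ denotes the number of vertices and $\delta(G)$ the minimum degree of $G$. For $R \subset V(G)$, $G(R)$ is the subgraph induced on $R$ and $G - R$ is the graph obtained by deleting $R$ and all incident edges. A set $R \subset V(G)$ is contractible if $G(R)$ is connected and $G - R$ is $2$-connected; it is $k$-contractible if moreover $|R| = k$. The paper writes $[x]$ for the integer part $\lfloor x \rfloor$. *)

theory Defs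
  imports "Graph_Theory.Digraph_Component"
begin

text \<open>
  A finite simple undirected graph is an instance of the locale \<open>graph\<close>: a finite symmetric
  digraph without loops or parallel arcs. An undirected edge \<open>uv\<close> is represented by the two arcs
  \<open>(u, v)\<close> and \<open>(v, u)\<close>, so \<open>out_degree\<close> is the usual degree. The library predicate \<open>connected\<close>
  is false for the graph without vertices.
\<close>

definition min_degree :: "('a, 'b) pre_digraph \<Rightarrow> nat" where
  "min_degree G = Min (out_degree G ` verts G)"

definition del_verts :: "('a, 'b) pre_digraph \<Rightarrow> 'a set \<Rightarrow> ('a, 'b) pre_digraph" where
  "del_verts G R = G \<restriction> (verts G - R)"

text \<open>
  The size condition is part of the usual definition: a 2-connected graph has at least three
  vertices, a 3-connected one at least four.
\<close>

definition vertex_connected :: "nat \<Rightarrow> ('a, 'b) pre_digraph \<Rightarrow> bool" where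
  "vertex_connected n G \<longleftrightarrow>
     card (verts G) > n \<and>
     (\<forall>S. S \<subseteq> verts G \<and> card S < n \<longrightarrow> connected (del_verts G S))"

definition contractible_set :: "('a, 'b) pre_digraph \<Rightarrow> 'a set \<Rightarrow> bool" where
  "contractible_set G R \<longleftrightarrow>
     R \<subseteq> verts G \<and> connected (G \<restriction> R) \<and> vertex_connected 2 (del_verts G R)"

definition k_contractible_set :: "nat \<Rightarrow> ('a, 'b) pre_digraph \<Rightarrow> 'a set \<Rightarrow> bool" where
  "k_contractible_set k G R \<longleftrightarrow> contractible_set G R \<and> card R = k"

end

theory Submission
  imports Defs
begin

text \<open>
  Let \<open>W\<close> be a contractible set of maximal size at most \<open>k\<close> and suppose \<open>card W < k\<close>. A proper
  2-connected subgraph \<open>S\<close> of \<open>H = G - W\<close>, maximal among those that miss some neighbour of \<open>W\<close>,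
  has as complement in \<open>H\<close> an induced path whose vertices have degree two in \<open>H\<close>, and all of them are
  adjacent to \<open>W\<close>. Moving the path to \<open>W\<close> gives a contractible set, so by maximality the path has at
  least \<open>k - card W + 1\<close> vertices. A second such path yields two further vertices of degree two in
  \<open>H\<close>. By the degree condition each of these vertices is adjacent to about two thirds of \<open>W\<close>, so
  a suitable \<open>y\<close> in \<open>W\<close> can be exchanged for \<open>k - card W + 1\<close> consecutive vertices of the path:
  \<open>y\<close> closes the remaining piece of the path to an ear, while \<open>W - y\<close> together with the removed
  vertices stays connected and has exactly \<open>k\<close> elements.
\<close>

subsection \<open>Connected sets, blocks and ears\<close>

text \<open>The edge relation is an argument of its own, so that a virtual edge can be added by
  \<open>insert\<close>. Nonemptiness agrees with \<open>connected\<close>, which is false for the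
  graph without vertices.\<close>

definition conn_on :: "'a rel \<Rightarrow> 'a set \<Rightarrow> bool" where
  "conn_on E X \<longleftrightarrow> X \<noteq> {} \<and> (\<forall>u\<in>X. \<forall>v\<in>X. (u, v) \<in> rtrancl_on X E)"

text \<open>
  Single edges count as blocks: this lets an edge serve as the start of an ear decomposition,
  and it covers the case in which \<open>G - W\<close> is a cycle.
\<close>

definition block_on :: "'a rel \<Rightarrow> 'a set \<Rightarrow> bool" where
  "block_on E S \<longleftrightarrow> card S \<ge> 2 \<and> conn_on E S \<and> (\<forall>v\<in>S. conn_on E (S - {v}))"

definition nbrs_in :: "'a rel \<Rightarrow> 'a set \<Rightarrow> 'a set \<Rightarrow> 'a set" where
  "nbrs_in E X C = {x \<in> X. \<exists>c\<in>C. (c, x) \<in> E}"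

text \<open>The list \<open>p\<close> holds only the interior vertices; they form a path from \<open>a\<close> to \<open>b\<close>.\<close>

definition ear :: "'a rel \<Rightarrow> 'a set \<Rightarrow> 'a \<Rightarrow> 'a list \<Rightarrow> 'a \<Rightarrow> bool" where
  "ear E S a p b \<longleftrightarrow> p \<noteq> [] \<and> distinct p \<and> successively (\<lambda>u v. (u, v) \<in> E) p \<and>
     set p \<inter> S = {} \<and> a \<in> S \<and> b \<in> S \<and> a \<noteq> b \<and> (a, hd p) \<in> E \<and> (last p, b) \<in> E"

section \<open>Gluing connected sets\<close>

lemma conn_on_root:
  assumes "sym E" "r \<in> X" "\<And>v. v \<in> X \<Longrightarrow> (r, v) \<in> rtrancl_on X E"
  shows "conn_on E X"
proof -
  have "(u, v) \<in> rtrancl_on X E" if "u \<in> X" "v \<in> X" for u v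
    using rtrancl_on_trans[OF symD[OF rtrancl_on_sym[OF assms(1)] assms(3)] assms(3)] that by blast
  then show ?thesis using assms(2) by (auto simp: conn_on_def)
qed

lemma conn_on_singleton: "conn_on E {x}"
  by (auto simp: conn_on_def)

lemma conn_on_mono:
  assumes "conn_on E X" "E \<subseteq> E'"
  shows "conn_on E' X"
  using assms rtrancl_on_mono[where F=X and G=X and s=E and r=E'] unfolding conn_on_def by blast

lemma conn_on_Un:
  assumes "sym E" "conn_on E X" "conn_on E Y" "X \<inter> Y \<noteq> {}"
  shows "conn_on E (X \<union> Y)"
proof -
  obtain r where r: "r \<in> X" "r \<in> Y" using assms by auto
  show ?thesis
  proof (rule conn_on_root[OF assms(1), of r])
    fix v assume "v \<in> X \<union> Y"
    then have "(r, v) \<in> rtrancl_on X E \<or> (r, v) \<in> rtrancl_on Y E"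
      using assms r by (auto simp: conn_on_def)
    then show "(r, v) \<in> rtrancl_on (X \<union> Y) E"
      using rtrancl_on_mono[where F=X and G="X \<union> Y" and s=E and r=E] rtrancl_on_mono[where F=Y and G="X \<union> Y" and s=E and r=E] by blast
  qed (use r in auto)
qed

lemma conn_on_pair: "sym E \<Longrightarrow> (x, y) \<in> E \<Longrightarrow> conn_on E {x, y}"
  by (rule conn_on_root[of E x]) (auto intro: rtrancl_on_into_rtrancl_on)

lemma conn_on_edge:
  assumes "sym E" "conn_on E X" "conn_on E Y" "x \<in> X" "y \<in> Y" "(x, y) \<in> E"
  shows "conn_on E (X \<union> Y)"
proof -
  have "conn_on E (X \<union> {x, y})"
    using assms by (intro conn_on_Un[OF assms(1,2) conn_on_pair]) auto
  then have "conn_on E ((X \<union> {x, y}) \<union> Y)"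
    by (rule conn_on_Un[OF assms(1) _ assms(3)]) (use assms in auto)
  moreover have "(X \<union> {x, y}) \<union> Y = X \<union> Y" using assms by auto
  ultimately show ?thesis by simp
qed

lemma conn_on_edge':
  assumes "sym E" "conn_on E X" "conn_on E Y" "x \<in> X" "y \<in> Y" "(y, x) \<in> E"
  shows "conn_on E (X \<union> Y)"
  using assms conn_on_edge symD by metis

lemma conn_on_list:
  assumes "sym E" "p \<noteq> []" "successively (\<lambda>u v. (u, v) \<in> E) p"
  shows "conn_on E (set p)"
  using assms(2,3)
proof (induction p)
  case (Cons x p)
  show ?case
  proof (cases "p = []")
    case False
    then have "conn_on E ({x} \<union> set p)"
      using Cons assms(1) by (intro conn_on_edge[of _ _ _ x "hd p"] conn_on_singleton)
        (auto simp: successively_Cons)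
    then show ?thesis by simp
  qed (simp add: conn_on_singleton)
qed simp

lemma conn_on_attach:
  assumes "sym E" "conn_on E X" "\<And>y. y \<in> Y \<Longrightarrow> \<exists>x\<in>X. (y, x) \<in> E" "finite Y"
  shows "conn_on E (X \<union> Y)"
  using assms(4,3)
proof (induction Y)
  case (insert y Y)
  then obtain x where "x \<in> X" "(y, x) \<in> E" by blast
  then have "conn_on E ((X \<union> Y) \<union> {y})"
    using insert by (intro conn_on_edge'[OF assms(1) _ conn_on_singleton, of _ x y]) auto
  then show ?case by simp
qed (use assms in simp)

text \<open>Without such an edge \<open>K\<close> would be closed under steps inside
  \<open>X\<close>, so no walk from \<open>u\<close> could reach \<open>v\<close>.\<close>

lemma conn_on_crossing:
  assumes "conn_on E X" "u \<in> X" "v \<in> X" "u \<in> K" "v \<notin> K"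
  obtains x y where "x \<in> X" "y \<in> X" "x \<in> K" "y \<notin> K" "(x, y) \<in> E"
proof (rule ccontr)
  assume "\<not> thesis"
  note no = this that
  have "(u, v) \<in> rtrancl_on X E" using assms by (auto simp: conn_on_def)
  then have "v \<in> K"
  proof (induction rule: rtrancl_on_induct)
    case (step y z)
    then show ?case using no by blast
  qed (use assms in auto)
  then show False using assms by simp
qed

section \<open>Components of induced subgraphs\<close>

definition component_of :: "'a rel \<Rightarrow> 'a set \<Rightarrow> 'a \<Rightarrow> 'a set" where
  "component_of E X u = {v. (u, v) \<in> rtrancl_on X E}"

lemma component_of_subset: "component_of E X u \<subseteq> X"
  by (auto simp: component_of_def dest: in_rtrancl_on_in_F)

lemma component_of_self: "u \<in> X \<Longrightarrow> u \<in> component_of E X u"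
  by (auto simp: component_of_def)

lemma component_of_closed:
  "x \<in> component_of E X u \<Longrightarrow> (x, y) \<in> E \<Longrightarrow> y \<in> X \<Longrightarrow> y \<in> component_of E X u"
  by (auto simp: component_of_def intro: rtrancl_on_into_rtrancl_on)

lemma conn_on_component:
  assumes "sym E" "u \<in> X"
  shows "conn_on E (component_of E X u)"
proof (rule conn_on_root[OF assms(1) component_of_self[OF assms(2)]])
  fix v assume "v \<in> component_of E X u"
  then have "(u, v) \<in> rtrancl_on X E" by (simp add: component_of_def)
  then show "(u, v) \<in> rtrancl_on (component_of E X u) E"
  proof (induction rule: rtrancl_on_induct)
    case base
    then show ?case using component_of_self assms by (intro rtrancl_on_refl) 
  next
    case (step y z)
    then have "z \<in> component_of E X u"
      by (auto simp: component_of_def intro: rtrancl_on_into_rtrancl_on)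
    then show ?case using step by (auto intro: rtrancl_on_into_rtrancl_on)
  qed
qed

section \<open>Paths and ears\<close>

lemma rtrancl_on_obtains_path:
  assumes "(u, v) \<in> rtrancl_on X E"
  obtains p where "p \<noteq> []" "hd p = u" "last p = v" "distinct p" "set p \<subseteq> X"
    "successively (\<lambda>x y. (x, y) \<in> E) p"
proof -
  from assms have "\<exists>p. p \<noteq> [] \<and> hd p = u \<and> last p = v \<and> distinct p \<and> set p \<subseteq> X \<and>
    successively (\<lambda>x y. (x, y) \<in> E) p"
  proof (induction rule: rtrancl_on_induct)
    case base
    then show ?case by (intro exI[of _ "[u]"]) auto
  next
    case (step y z)
    then obtain p where p: "p \<noteq> []" "hd p = u" "last p = y" "distinct p" "set p \<subseteq> X"
      "successively (\<lambda>x y. (x, y) \<in> E) p" by blast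
    show ?case
    proof (cases "z \<in> set p")
      case True
      then obtain q r where "p = q @ z # r" by (meson split_list)
      then show ?thesis using p
        by (intro exI[of _ "q @ [z]"]) (auto simp: hd_append successively_append_iff)
    next
      case False
      then show ?thesis using p step
        by (intro exI[of _ "p @ [z]"]) (auto simp: successively_append_iff)
    qed
  qed
  then show ?thesis using that by blast
qed

lemma ear_exists:
  assumes "conn_on E C" "C \<inter> S = {}" "sym E" "a \<in> nbrs_in E S C" "b \<in> nbrs_in E S C" "a \<noteq> b"
  obtains p where "ear E S a p b" "set p \<subseteq> C"
proof -
  obtain u v where uv: "u \<in> C" "v \<in> C" "(u, a) \<in> E" "(v, b) \<in> E" "a \<in> S" "b \<in> S"
    using assms by (auto simp: nbrs_in_def)
  then have "(u, v) \<in> rtrancl_on C E" using assms by (auto simp: conn_on_def)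
  then obtain p where p: "p \<noteq> []" "hd p = u" "last p = v" "distinct p" "set p \<subseteq> C"
    "successively (\<lambda>x y. (x, y) \<in> E) p" by (rule rtrancl_on_obtains_path)
  then have "ear E S a p b"
    using uv assms by (auto simp: ear_def dest: symD)
  then show ?thesis using p that by blast
qed

text \<open>Deleting an interior vertex leaves at most two pieces of the ear, one attached at
  \<open>a\<close> and the other at \<open>b\<close>.\<close>

lemma conn_on_ear_minus:
  assumes "sym E" "ear E S a p b" "conn_on E X" "a \<in> X" "b \<in> X" "v \<in> set p"
  shows "conn_on E (X \<union> (set p - {v}))"
proof -
  note e = assms(2)[unfolded ear_def]
  obtain us ws where p: "p = us @ v # ws" using assms(6) by (meson split_list)
  have 1: "conn_on E (X \<union> set us)"
  proof (cases "us = []")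
    case False
    then show ?thesis using e p assms
      by (intro conn_on_edge[OF assms(1,3) conn_on_list, of us a "hd us"])
        (auto simp: successively_append_iff)
  qed (use assms in simp)
  have 2: "conn_on E ((X \<union> set us) \<union> set ws)"
  proof (cases "ws = []")
    case False
    then show ?thesis using e p assms 1
      by (intro conn_on_edge'[OF assms(1) 1 conn_on_list, of ws b "last ws"])
        (auto simp: successively_append_iff successively_Cons)
  qed (use 1 in simp)
  have "(X \<union> set us) \<union> set ws = X \<union> (set p - {v})" using e p by auto
  then show ?thesis using 2 by simp
qed

lemma conn_on_ear_left:
  assumes "sym E" "ear E S a p b" "conn_on E X" "a \<in> X"
  shows "conn_on E (X \<union> set p)"
  using assms by (intro conn_on_edge[OF assms(1,3) conn_on_list, of p a "hd p"]) (auto simp: ear_def)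

lemma conn_on_ear_right:
  assumes "sym E" "ear E S a p b" "conn_on E X" "b \<in> X"
  shows "conn_on E (X \<union> set p)"
  using assms by (intro conn_on_edge'[OF assms(1,3) conn_on_list, of p b "last p"]) (auto simp: ear_def)

text \<open>After the deletion of a vertex of \<open>S\<close> at least one end of the ear remains
  and holds the interior; after the deletion of an interior vertex the pieces hang on
  \<open>a\<close> and \<open>b\<close>.\<close>

lemma block_on_add_ear:
  assumes "sym E" "finite S" "block_on E S" "ear E S a p b"
  shows "block_on E (S \<union> set p)"
proof -
  note e = assms(4)[unfolded ear_def]
  have S: "card S \<ge> 2" "conn_on E S" "\<And>v. v \<in> S \<Longrightarrow> conn_on E (S - {v})"
    using assms by (auto simp: block_on_def)
  have "card S \<le> card (S \<union> set p)" using assms by (intro card_mono) auto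
  moreover have "conn_on E (S \<union> set p)"
    using conn_on_ear_left[OF assms(1,4)] S e by simp
  moreover have "conn_on E (S \<union> set p - {v})" if v: "v \<in> S \<union> set p" for v
  proof (cases "v \<in> S")
    case True
    have eq: "S \<union> set p - {v} = (S - {v}) \<union> set p" using True e by auto
    show ?thesis
    proof (cases "v = a")
      case True
      then show ?thesis unfolding eq using conn_on_ear_right[OF assms(1,4), of "S - {a}"] S(3) e by auto
    next
      case False
      then show ?thesis unfolding eq using conn_on_ear_left[OF assms(1,4)] S e \<open>v \<in> S\<close> by simp
    qed
  next
    case False
    then have "v \<in> set p" "S \<union> set p - {v} = S \<union> (set p - {v})" using v by auto
    then show ?thesis using conn_on_ear_minus[OF assms(1,4), of S v] S e by simp
  qed
  ultimately show ?thesis using S by (auto simp: block_on_def)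
qed

section \<open>Replacing a virtual edge by an ear\<close>

lemma conn_on_replace_edge:
  assumes "sym E" "conn_on (insert (a, b) (insert (b, a) E)) X" "conn_on E Q"
    "a \<in> X" "a \<in> Q" "b \<in> Q"
  shows "conn_on E (X \<union> Q)"
proof (rule conn_on_root[OF assms(1)])
  show "a \<in> X \<union> Q" using assms by simp
  have Q: "(u, v) \<in> rtrancl_on (X \<union> Q) E" if "u \<in> Q" "v \<in> Q" for u v
    using assms that rtrancl_on_mono[where F=Q and G="X \<union> Q" and s=E and r=E] by (auto simp: conn_on_def)
  fix v assume "v \<in> X \<union> Q"
  then consider "v \<in> Q" | "v \<in> X" by auto
  then show "(a, v) \<in> rtrancl_on (X \<union> Q) E"
  proof cases
    case 2
    then have "(a, v) \<in> rtrancl_on X (insert (a, b) (insert (b, a) E))"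
      using assms by (auto simp: conn_on_def)
    then show ?thesis
    proof (induction rule: rtrancl_on_induct)
      case base
      then show ?case by auto
    next
      case (step y z)
      show ?case
      proof (cases "(y, z) \<in> E")
        case True
        then show ?thesis using step by (auto intro: rtrancl_on_into_rtrancl_on)
      next
        case False
        \<comment> \<open>The step uses the virtual edge, so it ends in \<open>a\<close> or
          \<open>b\<close>, and \<open>a\<close> reaches both inside \<open>Q\<close>.\<close>
        then have "z \<in> {a, b}" using step by auto
        then show ?thesis using Q[of a z] assms by auto
      qed
    qed
  qed (use Q assms in auto)
qed

lemma conn_on_insert_edge:
  assumes "conn_on (insert (a, b) (insert (b, a) E)) X" "a \<notin> X \<or> b \<notin> X"
  shows "conn_on E X"
proof -
  have "(u, v) \<in> rtrancl_on X E" if "(u, v) \<in> rtrancl_on X (insert (a, b) (insert (b, a) E))" for u v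
    using that
  proof (induction rule: rtrancl_on_induct)
    case base
    then show ?case by auto
  next
    case (step y z)
    then have "(y, z) \<in> E" using assms by auto
    then show ?case using step by (auto intro: rtrancl_on_into_rtrancl_on)
  qed
  then show ?thesis using assms by (auto simp: conn_on_def)
qed

text \<open>Here \<open>S\<close> is a block only with the virtual edge \<open>ab\<close>, and the
  ear takes over the role of that edge. For \<open>S = {a, b}\<close> the union could be a mere
  path.\<close>

lemma block_on_subdivide_edge:
  assumes "sym E" "finite S" "block_on (insert (a, b) (insert (b, a) E)) S" "card S \<ge> 3"
    "ear E S a p b"
  shows "block_on E (S \<union> set p)"
proof -
  let ?E = "insert (a, b) (insert (b, a) E)"
  note e = assms(5)[unfolded ear_def]
  have S: "card S \<ge> 2" "conn_on ?E S" "\<And>v. v \<in> S \<Longrightarrow> conn_on ?E (S - {v})"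
    using assms by (auto simp: block_on_def)
  have ca: "conn_on E (S - {a})" and cb: "conn_on E (S - {b})"
    using conn_on_insert_edge[OF S(3)] e by auto
  have ba: "b \<in> S - {a}" "a \<in> S - {b}" using e by auto
  \<comment> \<open>A third vertex lies in both \<open>S - {a}\<close> and \<open>S - {b}\<close>,
    which are connected by real edges alone.\<close>
  have "card (S - {a, b}) \<noteq> 0" using assms(4) e by (simp add: card_Diff_subset)
  then have "S - {a, b} \<noteq> {}" by fastforce
  then have "conn_on E ((S - {a}) \<union> (S - {b}))"
    by (intro conn_on_Un assms(1) ca cb) auto
  moreover have "(S - {a}) \<union> (S - {b}) = S" using e by auto
  ultimately have c: "conn_on E S" by simp
  have "conn_on E ({a} \<union> set p)" "conn_on E ({a} \<union> set p \<union> {b})"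
  proof -
    show 1: "conn_on E ({a} \<union> set p)"
      using conn_on_ear_left[OF assms(1,5) conn_on_singleton] by simp
    show "conn_on E ({a} \<union> set p \<union> {b})"
      using e by (intro conn_on_edge[OF assms(1) 1 conn_on_singleton, of "last p" b]) auto
  qed
  note Q = this(2)
  have "card S \<le> card (S \<union> set p)" using assms by (intro card_mono) auto
  moreover have "conn_on E (S \<union> set p)"
    using conn_on_ear_left[OF assms(1,5)] c e by simp
  moreover have "conn_on E (S \<union> set p - {v})" if v: "v \<in> S \<union> set p" for v
  proof (cases "v \<in> S")
    case True
    have eq: "S \<union> set p - {v} = (S - {v}) \<union> set p" using True e by auto
    consider "v = a" | "v = b" | "v \<noteq> a" "v \<noteq> b" by blast
    then show ?thesis
    proof cases
      case 1
      then show ?thesis unfolding eq using conn_on_ear_right[OF assms(1,5) ca] ba by simp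
    next
      case 2
      then show ?thesis unfolding eq using conn_on_ear_left[OF assms(1,5) cb] ba by simp
    next
      case 3
      have "conn_on E ((S - {v}) \<union> ({a} \<union> set p \<union> {b}))"
        using conn_on_replace_edge[OF assms(1) S(3)[OF True] Q] 3 e by auto
      moreover have "(S - {v}) \<union> ({a} \<union> set p \<union> {b}) = S - {v} \<union> set p" using 3 e by auto
      ultimately show ?thesis unfolding eq by simp
    qed
  next
    case False
    then have "v \<in> set p" "S \<union> set p - {v} = S \<union> (set p - {v})" using v by auto
    then show ?thesis using conn_on_ear_minus[OF assms(1,5), of S v] c e by simp
  qed
  ultimately show ?thesis using S by (auto simp: block_on_def)
qed

text \<open>
  The parent function \<open>f\<close> of a breadth-first search tree rooted at \<open>z\<close> maps the non-neighbours
  of \<open>z\<close> to at most \<open>card W - deg z\<close> vertices, and every vertex outside this image can be removed.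
\<close>

lemma conn_on_exchange:
  assumes "sym E" "conn_on E W" "finite W" "z \<notin> W" "nbrs_in E W {z} \<noteq> {}"
    and "Y \<subseteq> W" "card Y > card W - card (nbrs_in E W {z})"
  obtains y where "y \<in> Y" "conn_on E (insert z (W - {y}))"
proof -
  define N where "N = nbrs_in E W {z}"
  have N: "N \<subseteq> W" "\<And>x. x \<in> N \<Longrightarrow> (z, x) \<in> E" by (auto simp: N_def nbrs_in_def)
  define X where "X = insert z W"
  obtain w where "w \<in> W" "(z, w) \<in> E" using assms(5) by (auto simp: nbrs_in_def)
  then have X: "conn_on E X"
    using conn_on_edge'[OF assms(1,2) conn_on_singleton, of w z z] by (simp add: X_def)
  \<comment> \<open>\<open>d\<close> is the distance from \<open>z\<close> inside \<open>X\<close>;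
    the parent \<open>f v\<close> chosen below is a neighbour of \<open>v\<close> closer to
    \<open>z\<close>.\<close>
  define d where "d v = (LEAST n. (z, v) \<in> (E \<inter> X \<times> X) ^^ n)" for v
  have reach: "(z, v) \<in> (E \<inter> X \<times> X)\<^sup>*" if "v \<in> X" for v
  proof -
    have "(z, v) \<in> rtrancl_on X E" using X that by (auto simp: conn_on_def X_def)
    then show ?thesis by (induction rule: rtrancl_on_induct) (auto intro: rtrancl_into_rtrancl)
  qed
  have "\<exists>u. u \<in> X \<and> (u, v) \<in> E \<and> d u < d v" if v: "v \<in> X" "v \<noteq> z" for v
  proof -
    have "\<exists>n. (z, v) \<in> (E \<inter> X \<times> X) ^^ n" using reach[OF v(1)] by (simp add: rtrancl_power)
    then have dv: "(z, v) \<in> (E \<inter> X \<times> X) ^^ d v" unfolding d_def by (rule LeastI_ex)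
    then obtain m where m: "d v = Suc m" using v dv by (cases "d v") auto
    then obtain u where u: "(z, u) \<in> (E \<inter> X \<times> X) ^^ m" "(u, v) \<in> E \<inter> X \<times> X"
      using dv by auto
    then have "d u \<le> m" unfolding d_def by (intro Least_le)
    then show ?thesis using u m by auto
  qed
  then obtain f where f: "\<And>v. v \<in> X \<Longrightarrow> v \<noteq> z \<Longrightarrow> f v \<in> X \<and> (f v, v) \<in> E \<and> d (f v) < d v"
    by metis
  have "card (f ` (W - N)) \<le> card (W - N)" using assms by (intro card_image_le) auto
  also have "\<dots> < card Y" using assms(3,7) N(1) finite_subset
    by (subst card_Diff_subset) (auto simp: N_def)
  finally have "\<not> Y \<subseteq> f ` (W - N)" using card_mono[of "f ` (W - N)" Y] assms(3) by auto
  then obtain y where y: "y \<in> Y" "y \<notin> f ` (W - N)" by blast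
  \<comment> \<open>Induction on the distance: vertices of \<open>N\<close> hang on \<open>z\<close>
    directly, and no other vertex of \<open>W\<close> has \<open>y\<close> as its parent.\<close>
  have "conn_on E (insert z (W - {y}))"
  proof (rule conn_on_root[OF assms(1), of z])
    fix v assume "v \<in> insert z (W - {y})"
    then show "(z, v) \<in> rtrancl_on (insert z (W - {y})) E"
    proof (induction "d v" arbitrary: v rule: less_induct)
      case less
      consider "v = z" | "v \<in> N" "v \<noteq> z" | "v \<in> W - N" "v \<noteq> z" using less.prems by auto
      then show ?case
      proof cases
        case 2
        then show ?thesis using N less.prems by (auto intro: rtrancl_on_into_rtrancl_on)
      next
        case 3
        then have "f v \<in> insert z (W - {y})" "(f v, v) \<in> E" "d (f v) < d v"
          using f[of v] y by (auto simp: X_def)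
        then show ?thesis using less by (auto intro: rtrancl_on_into_rtrancl_on)
      qed auto
    qed
  qed auto
  then show ?thesis using that y by blast
qed

subsection \<open>Maximal proper blocks\<close>

text \<open>The first and the last vertex of \<open>F\<close> on \<open>p\<close> enclose all
  others, so a detour between these two bypasses the rest of \<open>F\<close>.\<close>

lemma first_last_occurrence:
  assumes "finite F" "card F \<ge> 2" "F \<subseteq> set p"
  obtains us z ms z' ws where "p = us @ z # ms @ z' # ws" "z \<in> F" "z' \<in> F" "F \<subseteq> {z, z'} \<union> set ms"
proof -
  have "\<exists>x\<in>set p. x \<in> F" using assms by (metis card.empty not_numeral_le_zero subset_empty subset_eq)
  then obtain us z vs where p: "p = us @ z # vs" "z \<in> F" "\<forall>x\<in>set us. x \<notin> F"
    using split_list_first_prop[of p "\<lambda>x. x \<in> F"] by blast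
  have "\<not> F \<subseteq> {z}" using assms card_mono[of "{z}" F] by auto
  then have "\<exists>x\<in>set vs. x \<in> F" using assms(3) p by auto
  then obtain ms z' ws where "vs = ms @ z' # ws" "z' \<in> F" "\<forall>x\<in>set ws. x \<notin> F"
    using split_list_last_prop[of vs "\<lambda>x. x \<in> F"] by blast
  then show ?thesis using that[of us z ms z' ws] p assms(3) by auto
qed

text \<open>
  By maximality of \<open>S\<close>, every connected subset of \<open>H - S\<close> with two neighbours in \<open>S\<close> contains
  \<open>Z - S\<close>. A component \<open>D\<close> of \<open>H - S - Z\<close> has at least three neighbours, so it could be used to
  reroute an ear around a vertex of \<open>Z\<close>; hence no such component exists.
\<close>

lemma maximal_block:
  assumes "sym E" "finite H" "block_on E H" "S\<^sub>0 \<subseteq> H" "block_on E S\<^sub>0" "Z \<subseteq> H" "\<not> Z \<subseteq> S\<^sub>0"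
    and sep: "\<And>D. D \<subseteq> H - (S\<^sub>0 \<union> Z) \<Longrightarrow> D \<noteq> {} \<Longrightarrow> card (nbrs_in E (H - D) D) \<ge> 3"
  obtains S a p b where "S\<^sub>0 \<subseteq> S" "S \<subseteq> H" "block_on E S" "H - S \<subseteq> Z"
    "ear E S a p b" "set p = H - S"
    "\<And>a p b. ear E S a p b \<Longrightarrow> set p \<subseteq> H - S \<Longrightarrow> set p = H - S"
proof -
  define P where "P S \<longleftrightarrow> S\<^sub>0 \<subseteq> S \<and> S \<subseteq> H \<and> block_on E S \<and> \<not> Z \<subseteq> S" for S
  have "P S\<^sub>0" using assms by (auto simp: P_def)
  moreover have "\<forall>S. P S \<longrightarrow> card S < Suc (card H)" using assms(2) by (auto simp: P_def less_Suc_eq_le intro: card_mono)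
  ultimately obtain S where PS: "P S" and max: "\<And>T. P T \<Longrightarrow> card T \<le> card S"
    using ex_has_greatest_nat[of P S\<^sub>0 card "Suc (card H)"] by auto
  have S: "S\<^sub>0 \<subseteq> S" "S \<subseteq> H" "block_on E S" "\<not> Z \<subseteq> S" using PS by (auto simp: P_def)
  have finS: "finite S" using S assms(2) finite_subset by auto
  \<comment> \<open>Adding the ear gives a larger block, which by maximality must contain all of
    \<open>Z\<close>.\<close>
  have ears: "Z - S \<subseteq> set p" if e: "ear E S a p b" and p: "set p \<subseteq> H - S" for a p b
  proof (rule ccontr)
    assume "\<not> Z - S \<subseteq> set p"
    then have "P (S \<union> set p)"
      using block_on_add_ear[OF assms(1) finS S(3) e] S p by (auto simp: P_def)
    then have "card (S \<union> set p) \<le> card S" by (rule max)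
    moreover have "card (S \<union> set p) = card S + card (set p)"
      using e finS by (intro card_Un_disjoint) (auto simp: ear_def)
    ultimately show False using e by (auto simp: ear_def)
  qed
  have conn: "Z - S \<subseteq> C" if C: "conn_on E C" "C \<subseteq> H - S" "a \<in> nbrs_in E S C" "b \<in> nbrs_in E S C" "a \<noteq> b"
    for C a b
  proof -
    obtain p where p: "ear E S a p b" "set p \<subseteq> C"
      by (rule ear_exists[OF C(1) _ assms(1) C(3,4,5)]) (use C(2) in auto)
    then show ?thesis using ears[of a p b] C by auto
  qed
  obtain z where z: "z \<in> Z" "z \<notin> S" using S by auto
  obtain a p b where p: "ear E S a p b" "set p \<subseteq> H - S"
  proof -
    define K where "K = component_of E (H - S) z"
    have zH: "z \<in> H - S" using z assms by auto
    have K: "K \<subseteq> H - S" "z \<in> K" "conn_on E K"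
      using component_of_subset[of E "H - S" z] component_of_self[OF zH]
        conn_on_component[OF assms(1) zH] by (auto simp: K_def)
    \<comment> \<open>With at most one neighbour in \<open>S\<close>, the component \<open>K\<close>
      could be cut off from another vertex of \<open>S\<close> by deleting a single vertex of the
      block \<open>H\<close>.\<close>
    have "\<exists>a b. a \<in> nbrs_in E S K \<and> b \<in> nbrs_in E S K \<and> a \<noteq> b"
    proof (rule ccontr)
      assume no: "\<not> ?thesis"
      have "S \<noteq> {}" using S by (auto simp: block_on_def)
      have "\<exists>s\<in>S. nbrs_in E S K \<subseteq> {s}"
      proof (cases "nbrs_in E S K = {}")
        case True
        then show ?thesis using \<open>S \<noteq> {}\<close> by blast
      next
        case False
        then obtain s where "s \<in> nbrs_in E S K" by blast
        moreover have "nbrs_in E S K \<subseteq> S" by (auto simp: nbrs_in_def)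
        ultimately show ?thesis using no by blast
      qed
      then obtain s where s: "s \<in> S" "nbrs_in E S K \<subseteq> {s}" by blast
      have "\<not> S \<subseteq> {s}" using S(3) card_mono[of "{s}" S] by (auto simp: block_on_def)
      then obtain s' where s': "s' \<in> S" "s' \<noteq> s" by auto
      have "conn_on E (H - {s})" using assms(3) s S by (auto simp: block_on_def)
      moreover have "z \<in> H - {s}" "s' \<in> H - {s}" "z \<in> K" "s' \<notin> K" using zH s s' K S by auto
      ultimately obtain x y where xy: "x \<in> H - {s}" "y \<in> H - {s}" "x \<in> K" "y \<notin> K" "(x, y) \<in> E"
        by (rule conn_on_crossing)
      show False
      proof (cases "y \<in> S")
        case True
        then show ?thesis using xy s by (auto simp: nbrs_in_def)
      next
        case False
        then show ?thesis using xy component_of_closed[of x E "H - S" z y] by (auto simp: K_def)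
      qed
    qed
    then obtain a b where ab: "a \<in> nbrs_in E S K" "b \<in> nbrs_in E S K" "a \<noteq> b" by blast
    obtain p where "ear E S a p b" "set p \<subseteq> K"
      by (rule ear_exists[OF K(3) _ assms(1) ab]) (use K in auto)
    then show thesis using that K by blast
  qed
  have "H - S \<subseteq> Z"
  proof (rule ccontr)
    assume "\<not> H - S \<subseteq> Z"
    then obtain u where u: "u \<in> H - S - Z" by auto
    define D where "D = component_of E (H - S - Z) u"
    have D: "D \<subseteq> H - S - Z" "u \<in> D" "conn_on E D"
      using component_of_subset[of E "H - S - Z" u] component_of_self[OF u]
        conn_on_component[OF assms(1) u] by (auto simp: D_def)
    define N where "N = nbrs_in E (H - D) D"
    define F where "F = N \<inter> (Z - S)"
    have N3: "card N \<ge> 3" unfolding N_def using D S by (intro sep) auto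
    have Nsub: "N \<subseteq> S \<union> (Z - S)"
    proof
      fix y assume "y \<in> N"
      then show "y \<in> S \<union> (Z - S)"
        using component_of_closed[of _ E "H - S - Z" u y] by (auto simp: N_def nbrs_in_def D_def)
    qed
    have adj: "\<exists>c\<in>D. (c, x) \<in> E" if "x \<in> N" for x using that by (auto simp: N_def nbrs_in_def)
    have finN: "finite N" using assms(2) by (auto simp: N_def nbrs_in_def)
    \<comment> \<open>Two neighbours in \<open>S\<close> would force the connected set
      \<open>D\<close> to contain \<open>Z - S\<close>, but \<open>D\<close> avoids
      \<open>Z\<close>.\<close>
    have oneS: "x = y" if "x \<in> N \<inter> S" "y \<in> N \<inter> S" for x y
    proof (rule ccontr)
      assume "x \<noteq> y"
      then have "Z - S \<subseteq> D" using that D adj by (intro conn[of D x y]) (auto simp: nbrs_in_def)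
      then show False using z D by auto
    qed
    then have "card (N \<inter> S) \<le> 1" using finN by (auto simp: card_le_Suc0_iff_eq)
    moreover have "N = (N \<inter> S) \<union> F" "(N \<inter> S) \<inter> F = {}" using Nsub by (auto simp: F_def)
    then have "card N = card (N \<inter> S) + card F" using finN by (metis card_Un_disjoint finite_Un)
    ultimately have F2: "card F \<ge> 2" using N3 by simp
    have Fp: "F \<subseteq> set p" using ears[OF p] by (auto simp: F_def)
    have finF: "finite F" using finN by (auto simp: F_def)
    obtain us y ms y' ws where q: "p = us @ y # ms @ y' # ws" "y \<in> F" "y' \<in> F" "F \<subseteq> {y, y'} \<union> set ms"
      by (rule first_last_occurrence[OF finF F2 Fp])
    note e = p(1)[unfolded ear_def q(1)]
    have L: "conn_on E (set (us @ [y]) \<union> D)"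
    proof -
      obtain c where "c \<in> D" "(c, y) \<in> E" using q adj by (auto simp: F_def)
      then show ?thesis using e
        by (intro conn_on_edge'[OF assms(1) conn_on_list[OF assms(1)] D(3), of _ y c])
          (auto simp: successively_append_iff successively_Cons)
    qed
    have R: "conn_on E (set (y' # ws) \<union> D)"
    proof -
      obtain c where "c \<in> D" "(c, y') \<in> E" using q adj by (auto simp: F_def)
      then show ?thesis using e
        by (intro conn_on_edge'[OF assms(1) conn_on_list[OF assms(1)] D(3), of _ y' c])
          (auto simp: successively_append_iff successively_Cons)
    qed
    have La: "a \<in> nbrs_in E S (set (us @ [y]) \<union> D)"
      using e symD[OF assms(1)] by (cases us) (auto simp: nbrs_in_def)
    have Rb: "b \<in> nbrs_in E S (set (y' # ws) \<union> D)"
      using e by (cases ws rule: rev_cases) (auto simp: nbrs_in_def split: if_splits)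
    have disj: "y \<notin> set (y' # ws)" "y' \<notin> set (us @ [y])" using e by auto
    have sub: "set (us @ [y]) \<subseteq> H - S" "set (y' # ws) \<subseteq> H - S" using p(2) q(1) by auto
    have yZ: "y \<in> Z - S" "y' \<in> Z - S" "y \<notin> D" "y' \<notin> D" using q D by (auto simp: F_def)
    \<comment> \<open>If \<open>F\<close> has only \<open>y\<close> and \<open>y'\<close>, a
      neighbour \<open>h\<close> of \<open>D\<close> in \<open>S\<close> and one end of the ear are
      two neighbours of a connected set that misses \<open>y\<close> or \<open>y'\<close>. Otherwise
      the route from \<open>a\<close> to \<open>b\<close> through \<open>D\<close> bypasses a vertex
      \<open>f\<close> of \<open>Z\<close>.\<close>
    show False
    proof (cases "F \<subseteq> {y, y'}")
      case True
      then have "card F \<le> 2" using card_mono[of "{y, y'}" F] by (auto simp: card_insert_if split: if_splits)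
      then have "N \<inter> S \<noteq> {}" using N3 \<open>card N = card (N \<inter> S) + card F\<close> by auto
      then obtain h where h: "h \<in> N" "h \<in> S" by auto
      show False
      proof (cases "h = b")
        case False
        have "Z - S \<subseteq> set (y' # ws) \<union> D"
          using R sub D Rb h adj[OF h(1)] False by (intro conn[of _ h b]) (auto simp: nbrs_in_def)
        then show False using yZ disj by blast
      next
        case True
        have "Z - S \<subseteq> set (us @ [y]) \<union> D"
          using L sub D La h adj[OF h(1)] True e by (intro conn[of _ a h]) (auto simp: nbrs_in_def)
        then show False using yZ disj by blast
      qed
    next
      case False
      then obtain f where f: "f \<in> F" "f \<in> set ms" using q by auto
      have "conn_on E ((set (us @ [y]) \<union> D) \<union> (set (y' # ws) \<union> D))"
        using D by (intro conn_on_Un[OF assms(1) L R]) auto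
      then have "Z - S \<subseteq> (set (us @ [y]) \<union> D) \<union> (set (y' # ws) \<union> D)"
        by (rule conn[of _ a b]) (use sub D La Rb e in \<open>auto simp: nbrs_in_def\<close>)
      moreover have "f \<in> Z - S" "f \<notin> D" using f D by (auto simp: F_def)
      ultimately show False using f e by auto
    qed
  qed
  then have all: "set p = H - S" if "ear E S a p b" "set p \<subseteq> H - S" for a p b
    using ears[OF that] that by auto
  show thesis
    by (rule that[OF S(1-3) \<open>H - S \<subseteq> Z\<close> p(1) all[OF p] all])
qed

text \<open>By \<open>cover\<close> no shorter ear runs inside \<open>set p\<close>, whereas any
  further edge from \<open>p ! i\<close> would be a shortcut. A single interior vertex admits no
  shortcut, hence the bound on the length.\<close>

lemma ear_nbrs:
  assumes "sym E" "irrefl E" "ear E S a p b" "length p \<ge> 2"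
    and cover: "\<And>a' q b'. ear E S a' q b' \<Longrightarrow> set q \<subseteq> set p \<Longrightarrow> set q = set p"
    and i: "i < length p"
  shows "nbrs_in E (S \<union> set p) {p ! i} \<subseteq>
    {if i = 0 then a else p ! (i - 1), if Suc i = length p then b else p ! Suc i}"
proof
  note e = assms(3)[unfolded ear_def]
  have lt: "last (take (Suc j) p) = p ! j" if "j < length p" for j
    using that by (simp add: take_Suc_conv_app_nth)
  have "a \<noteq> b" using e by simp
  fix x assume x: "x \<in> nbrs_in E (S \<union> set p) {p ! i}"
  then have xE: "(p ! i, x) \<in> E" by (auto simp: nbrs_in_def)
  have lenne: "False" if "ear E S a' q b'" "set q \<subseteq> set p" "length q < length p" for a' q b'
  proof -
    have "set q = set p" using cover that by blast
    then have "length q = length p" using that e by (metis distinct_card ear_def)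
    then show ?thesis using that by simp
  qed
  have st: "successively (\<lambda>u v. (u, v) \<in> E) (take n p)"
    and sd: "successively (\<lambda>u v. (u, v) \<in> E) (drop n p)" for n
    using e successively_append_iff[of "\<lambda>u v. (u, v) \<in> E" "take n p" "drop n p"] by auto
  have St: "set (take n p) \<inter> S = {}" and Sd: "set (drop n p) \<inter> S = {}" for n
    using e set_take_subset[of n p] set_drop_subset[of n p] by blast+
  \<comment> \<open>An edge from \<open>p ! i\<close> to \<open>S\<close> lets the ear end early or,
    for \<open>drop\<close>, start late.\<close>
  have take: "ear E S a (take (Suc i) p) c" if "c \<in> S" "c \<noteq> a" "(p ! i, c) \<in> E" for c
    unfolding ear_def using that e i lt[of i] st[of "Suc i"] St[of "Suc i"] by simp
  have drop: "ear E S c (drop i p) b" if "c \<in> S" "c \<noteq> b" "(p ! i, c) \<in> E" for c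
    unfolding ear_def using that e i sd[of i] Sd[of i] symD[OF assms(1) that(3)]
    by (simp add: hd_drop_conv_nth)
  have chord: False if jk: "j < k" "k < length p" "Suc j \<noteq> k" "(p ! j, p ! k) \<in> E" for j k
  proof -
    have "set (take (Suc j) p) \<inter> set (drop k p) = {}"
      using e jk by (intro set_take_disj_set_drop_if_distinct) auto
    moreover have "last (take (Suc j) p) = p ! j" "hd (drop k p) = p ! k"
      using jk by (auto simp: lt hd_drop_conv_nth)
    moreover have "take (Suc j) p \<noteq> []" "drop k p \<noteq> []" using jk by auto
    ultimately have "ear E S a (take (Suc j) p @ drop k p) b"
      unfolding ear_def using e jk st[of "Suc j"] sd[of k] St[of "Suc j"] Sd[of k]
      by (simp add: successively_append_iff Int_Un_distrib2)
    then show False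
      by (rule lenne) (use jk set_take_subset[of "Suc j" p] set_drop_subset[of k p] in auto)
  qed
  show "x \<in> {if i = 0 then a else p ! (i - 1), if Suc i = length p then b else p ! Suc i}"
  proof (cases "x \<in> S")
    case True
    have "x = a \<or> Suc i = length p"
    proof (rule ccontr)
      assume "\<not> ?thesis"
      then show False using lenne[OF take[OF True _ xE] set_take_subset] i by simp
    qed
    moreover have "x = b \<or> i = 0"
    proof (rule ccontr)
      assume "\<not> ?thesis"
      then have "x \<noteq> b" "length (drop i p) < length p" using i by auto
      then show False using lenne[OF drop[OF True _ xE] set_drop_subset] by blast
    qed
    ultimately show ?thesis using \<open>a \<noteq> b\<close> assms(4) by auto
  next
    case False
    then obtain j where j: "j < length p" "x = p ! j"
      using x by (auto simp: nbrs_in_def in_set_conv_nth)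
    have "j \<noteq> i" using xE j assms(2) by (auto simp: irrefl_def)
    moreover have "j = Suc i" if "i < j" using chord[OF that j(1)] xE j by auto
    moreover have "i = Suc j" if "j < i" using chord[OF that i] symD[OF assms(1) xE] j by auto
    ultimately consider "j = Suc i" | "i = Suc j" by linarith
    then show ?thesis using j by cases auto
  qed
qed

lemma block_on_mono:
  assumes "block_on E S" "E \<subseteq> E'"
  shows "block_on E' S"
  using assms conn_on_mono[OF _ assms(2)] by (auto simp: block_on_def)

lemma block_on_edge:
  assumes "sym E" "(u, v) \<in> E" "u \<noteq> v"
  shows "block_on E {u, v}"
proof -
  have "{u, v} - {u} = {v}" "{u, v} - {v} = {u}" using assms by auto
  then show ?thesis
    using assms conn_on_pair[OF assms(1,2)] conn_on_singleton[of E] by (auto simp: block_on_def)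
qed

subsection \<open>Contractible sets in 3-connected graphs\<close>

locale three_connected =
  fixes E :: "'a rel" and V :: "'a set"
  assumes symE: "sym E" and irreflE: "irrefl E" and finV: "finite V"
    and card_V: "card V > 3"
    and conn3: "\<And>S. S \<subseteq> V \<Longrightarrow> card S < 3 \<Longrightarrow> conn_on E (V - S)"
begin

text \<open>The bound on \<open>card (V - R)\<close> rules out a single edge, which counts as a
  block but is not 2-connected.\<close>

definition contractible :: "'a set \<Rightarrow> bool" where
  "contractible R \<longleftrightarrow> R \<subseteq> V \<and> conn_on E R \<and> card (V - R) \<ge> 3 \<and> block_on E (V - R)"

lemma finite_sub: "X \<subseteq> V \<Longrightarrow> finite X"
  using finV finite_subset by blast

text \<open>Fewer than three neighbours of \<open>D\<close> would separate \<open>D\<close> from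
  \<open>w\<close>, against 3-connectivity.\<close>

lemma three_nbrs:
  assumes "D \<subseteq> V" "D \<noteq> {}" "w \<in> V" "w \<notin> D" "w \<notin> nbrs_in E (V - D) D"
  shows "card (nbrs_in E (V - D) D) \<ge> 3"
proof (rule ccontr)
  let ?N = "nbrs_in E (V - D) D"
  assume "\<not> ?thesis"
  then have c: "conn_on E (V - ?N)" by (intro conn3) (auto simp: nbrs_in_def)
  obtain d where d: "d \<in> D" using assms by auto
  then have "d \<in> V - ?N" "w \<in> V - ?N" using assms by (auto simp: nbrs_in_def)
  then obtain x y where "x \<in> V - ?N" "y \<in> V - ?N" "x \<in> D" "y \<notin> D" "(x, y) \<in> E"
    using conn_on_crossing[OF c _ _ d assms(4)] by metis
  then show False by (auto simp: nbrs_in_def)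
qed

text \<open>Singletons start the search for a maximal contractible set.\<close>

lemma contractible_singleton:
  assumes "v \<in> V"
  shows "contractible {v}"
proof -
  have "conn_on E (V - {v} - {u})" if "u \<in> V - {v}" for u
  proof -
    have "conn_on E (V - {v, u})"
      using that assms by (intro conn3) (auto simp: card_insert_if)
    moreover have "V - {v} - {u} = V - {v, u}" by auto
    ultimately show ?thesis by simp
  qed
  moreover have "conn_on E (V - {v})" using assms by (intro conn3) auto
  moreover have "card (V - {v}) \<ge> 3" using assms card_V by simp
  ultimately show ?thesis
    using assms by (auto simp: contractible_def block_on_def conn_on_singleton)
qed

text \<open>\<open>maximal_block\<close> is applied to \<open>V - W\<close>, a single edge and the
  set \<open>Z\<close> of neighbours of \<open>W\<close>. Its condition on \<open>D\<close> follows
  from 3-connectivity, since a set outside \<open>Z\<close> has no neighbour in \<open>W\<close>.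
  The ear is long because moving it to \<open>W\<close> would give a larger contractible
  set.\<close>

lemma first_ear:
  assumes W: "contractible W" "card W < k" "card V \<ge> k + 3"
    and long: "\<And>R. contractible R \<Longrightarrow> W \<subset> R \<Longrightarrow> k < card R"
  obtains S a p b where "S \<subseteq> V - W" "block_on E S" "ear E S a p b" "set p = V - W - S"
    "\<And>a' p' b'. ear E S a' p' b' \<Longrightarrow> set p' \<subseteq> set p \<Longrightarrow> set p' = set p"
    "length p > k - card W"
proof -
  define H where "H = V - W"
  define Z where "Z = nbrs_in E H W"
  have WV: "W \<subseteq> V" "W \<noteq> {}" "conn_on E W" "block_on E H"
    using W by (auto simp: contractible_def conn_on_def H_def)
  obtain w where w: "w \<in> W" using WV by auto
  have fin: "finite W" "finite H" using WV finite_sub by (auto simp: H_def)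
  have cardH: "card H \<ge> 4" "card H = card V - card W"
    using W WV fin card_Diff_subset[of W V] by (auto simp: H_def)
  have Z3: "card Z \<ge> 3"
  proof (cases "Z = H")
    case False
    then obtain h where "h \<in> H" "h \<notin> Z" by (auto simp: Z_def nbrs_in_def)
    then show ?thesis using three_nbrs[OF WV(1,2), of h] by (auto simp: H_def Z_def)
  qed (use cardH in simp)
  obtain u v where uv: "u \<in> H" "v \<in> H" "u \<noteq> v" "(u, v) \<in> E"
  proof -
    obtain u where u: "u \<in> H" using cardH by fastforce
    have "\<not> H \<subseteq> {u}" using cardH card_mono[of "{u}" H] by auto
    then obtain v where v: "v \<in> H" "v \<noteq> u" by auto
    have cH: "conn_on E H" using WV by (auto simp: block_on_def)
    show thesis
      using conn_on_crossing[OF cH u v(1), of "{u}"] v that by blast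
  qed
  have "\<not> Z \<subseteq> {u, v}"
    using Z3 card_mono[of "{u, v}" Z] uv by auto
  moreover have "card (nbrs_in E (H - D) D) \<ge> 3" if D: "D \<subseteq> H - ({u, v} \<union> Z)" "D \<noteq> {}" for D
  proof -
    have noW: "(d, x) \<notin> E" if "d \<in> D" "x \<in> W" for d x
      using that D symD[OF symE] by (auto simp: Z_def nbrs_in_def)
    then have "nbrs_in E (V - D) D = nbrs_in E (H - D) D"
      by (auto simp: nbrs_in_def H_def)
    moreover have "w \<notin> nbrs_in E (V - D) D" using noW w by (auto simp: nbrs_in_def)
    then have "card (nbrs_in E (V - D) D) \<ge> 3"
      using D w WV by (intro three_nbrs[of _ w]) (auto simp: H_def)
    ultimately show ?thesis by simp
  qed
  moreover have "{u, v} \<subseteq> H" "Z \<subseteq> H" using uv by (auto simp: Z_def nbrs_in_def)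
  ultimately obtain S a p b where S: "{u, v} \<subseteq> S" "S \<subseteq> H" "block_on E S" "H - S \<subseteq> Z"
    "ear E S a p b" "set p = H - S"
    "\<And>a p b. ear E S a p b \<Longrightarrow> set p \<subseteq> H - S \<Longrightarrow> set p = H - S"
    using maximal_block[OF symE fin(2) WV(4) _ block_on_edge[OF symE uv(4,3)], of Z] by metis
  have finS: "finite S" by (rule finite_subset[OF S(2) fin(2)])
  have len: "length p = card (set p)" using S(5) by (simp add: ear_def distinct_card)
  have "length p > k - card W"
  proof (cases "card S \<ge> 3")
    case True
    have "\<exists>x\<in>W. (y, x) \<in> E" if "y \<in> set p" for y
      using that S(4,6) symD[OF symE] by (force simp: Z_def nbrs_in_def)
    then have "conn_on E (W \<union> set p)" by (intro conn_on_attach symE WV) auto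
    moreover have VS: "V - (W \<union> set p) = S" using S(2,6) by (auto simp: H_def)
    ultimately have "contractible (W \<union> set p)"
      using True S(2,3,6) WV by (auto simp: contractible_def H_def)
    moreover have "W \<subset> W \<union> set p"
      using S(5,6) by (cases p) (auto simp: ear_def H_def)
    ultimately have "k < card (W \<union> set p)" by (rule long)
    also have "\<dots> \<le> card W + length p" using card_Un_le[of W "set p"] len by simp
    finally show ?thesis using W(2) by linarith
  next
    \<comment> \<open>Now \<open>S\<close> is a single edge, the ear is all the rest of
      \<open>V - W\<close>, and \<open>card V \<ge> k + 3\<close> makes it long enough.\<close>
    case False
    have "card (set p) = card H - card S"
      using S(2,6) finS by (simp add: card_Diff_subset)
    then show ?thesis using False len cardH W by simp
  qed
  then show thesis using that[of S a p b] S(2,3,5-7) unfolding H_def by simp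
qed

text \<open>
  Adding the virtual edge \<open>ab\<close> in place of the first ear keeps \<open>a\<close> and \<open>b\<close> out of the second
  ear, whose vertices therefore have degree two in \<open>V - W\<close> as well.
\<close>

lemma second_ear:
  assumes W: "contractible W" "card W < k"
    and long: "\<And>R. contractible R \<Longrightarrow> W \<subset> R \<Longrightarrow> k < card R"
    and S: "S \<subseteq> V - W" "block_on E S"
    and p: "ear E S a p b" "set p = V - W - S" "length p \<ge> 2"
    and cover: "\<And>a' p' b'. ear E S a' p' b' \<Longrightarrow> set p' \<subseteq> set p \<Longrightarrow> set p' = set p"
  obtains q q' where "q \<in> S" "q' \<in> S" "q \<noteq> q'" "q \<noteq> a"
    "card (nbrs_in E (V - W) {q}) \<le> 2" "card (nbrs_in E (V - W) {q'}) \<le> 2"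
proof -
  define H where "H = V - W"
  have H: "H = S \<union> set p" using S p by (auto simp: H_def)
  note e = p(1)[unfolded ear_def]
  have ab: "a \<in> S" "b \<in> S" "a \<noteq> b" using e by auto
  have WV: "W \<subseteq> V" "W \<noteq> {}" "conn_on E W"
    using W by (auto simp: contractible_def conn_on_def)
  obtain w where w: "w \<in> W" using WV by auto
  have "S \<subseteq> V" using S by auto
  then have fin: "finite W" "finite H" "finite S"
    using finite_sub WV by (auto simp: H_def)
  have deg: "nbrs_in E (S \<union> set p) {p ! i} \<subseteq>
    {if i = 0 then a else p ! (i - 1), if Suc i = length p then b else p ! Suc i}" if "i < length p" for i
    by (rule ear_nbrs[OF symE irreflE p(1,3) cover that])
  have ends: "(s = a \<and> i = 0) \<or> (s = b \<and> Suc i = length p)"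
    if "i < length p" "s \<in> S" "(p ! i, s) \<in> E" for i s
  proof -
    have "s \<in> nbrs_in E (S \<union> set p) {p ! i}" using that by (auto simp: nbrs_in_def)
    then have "s \<in> {if i = 0 then a else p ! (i - 1), if Suc i = length p then b else p ! Suc i}"
      using deg[OF that(1)] by blast
    moreover have "s \<notin> set p" using that e by auto
    then have "s \<noteq> p ! (i - 1)" "Suc i < length p \<Longrightarrow> s \<noteq> p ! Suc i" using that by auto
    ultimately show ?thesis using that(1) by (auto split: if_splits)
  qed
  show thesis
  proof (cases "S \<subseteq> {a, b}")
    case True
    \<comment> \<open>\<open>V - W\<close> is the cycle formed by the ear and the edge
      \<open>ab\<close>, so \<open>a\<close> and \<open>b\<close> themselves have degree two in
      it.\<close>
    then have Sab: "S = {a, b}" using e by auto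
    have "nbrs_in E H {b} \<subseteq> {a, last p}"
    proof
      fix x assume "x \<in> nbrs_in E H {b}"
      then have x: "x \<in> S \<union> set p" "(b, x) \<in> E" by (auto simp: nbrs_in_def H)
      show "x \<in> {a, last p}"
      proof (cases "x \<in> set p")
        case True
        then obtain i where i: "i < length p" "x = p ! i" by (auto simp: in_set_conv_nth)
        then have "Suc i = length p" using ends[of i b] ab symD[OF symE x(2)] by auto
        then have "length p - 1 = i" by simp
        then show ?thesis using i e by (simp add: last_conv_nth)
      next
        case False
        then have "x \<in> {a, b}" using x(1) Sab by simp
        moreover have "(x, x) \<notin> E" using irreflE by (simp add: irrefl_def)
        ultimately show ?thesis using x(2) by auto
      qed
    qed
    moreover have "nbrs_in E H {a} \<subseteq> {b, hd p}"
    proof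
      fix x assume "x \<in> nbrs_in E H {a}"
      then have x: "x \<in> S \<union> set p" "(a, x) \<in> E" by (auto simp: nbrs_in_def H)
      show "x \<in> {b, hd p}"
      proof (cases "x \<in> set p")
        case True
        then obtain i where i: "i < length p" "x = p ! i" by (auto simp: in_set_conv_nth)
        then have "i = 0" using ends[of i a] ab symD[OF symE x(2)] by auto
        then show ?thesis using i e by (simp add: hd_conv_nth)
      next
        case False
        then have "x \<in> {a, b}" using x(1) Sab by simp
        moreover have "(x, x) \<notin> E" using irreflE by (simp add: irrefl_def)
        ultimately show ?thesis using x(2) by auto
      qed
    qed
    moreover have "card X \<le> 2" if "X \<subseteq> {x, y}" for X and x y :: 'a
      using card_mono[OF _ that] by (auto simp: card_insert_if split: if_splits)
    ultimately show ?thesis using that[of b a] e unfolding H_def by blast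
  next
    case False
    define E' where "E' = insert (a, b) (insert (b, a) E)"
    define Z where "Z = nbrs_in E S W"
    have E': "sym E'" "irrefl E'" "E \<subseteq> E'"
      using symE irreflE ab by (auto simp: E'_def sym_def irrefl_def)
    have inner: "(s, x) \<notin> E" if "s \<in> S - {a, b}" "x \<in> set p" for s x
    proof
      assume "(s, x) \<in> E"
      obtain i where "i < length p" "x = p ! i" using \<open>x \<in> set p\<close> by (auto simp: in_set_conv_nth)
      then show False using ends[of i s] symD[OF symE \<open>(s, x) \<in> E\<close>] that by auto
    qed
    \<comment> \<open>All neighbours of \<open>D\<close> lie in \<open>S\<close>: \<open>D\<close>
      sees neither \<open>W\<close> nor, as it avoids \<open>a\<close> and \<open>b\<close>, the
      first ear.\<close>
    have bigger: "nbrs_in E (V - D) D \<subseteq> nbrs_in E' (S - D) D" "card (nbrs_in E (V - D) D) \<ge> 3"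
      if D: "D \<subseteq> S - ({a, b} \<union> Z)" "D \<noteq> {}" for D
    proof -
      have noW: "(d, x) \<notin> E" if "d \<in> D" "x \<in> W" for d x
        using that D symD[OF symE] by (auto simp: Z_def nbrs_in_def)
      then have "w \<notin> nbrs_in E (V - D) D" using w by (auto simp: nbrs_in_def)
      then show "card (nbrs_in E (V - D) D) \<ge> 3"
        using D S w WV by (intro three_nbrs) auto
      show "nbrs_in E (V - D) D \<subseteq> nbrs_in E' (S - D) D"
      proof
        fix x assume "x \<in> nbrs_in E (V - D) D"
        then obtain d where d: "d \<in> D" "(d, x) \<in> E" "x \<in> V - D" by (auto simp: nbrs_in_def)
        then have "x \<notin> W" "x \<notin> set p" using noW inner[of d x] D by auto
        then show "x \<in> nbrs_in E' (S - D) D" using d p(2) E' by (auto simp: nbrs_in_def)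
      qed
    qed
    have sep: "card (nbrs_in E' (S - D) D) \<ge> 3" if "D \<subseteq> S - ({a, b} \<union> Z)" "D \<noteq> {}" for D
    proof -
      have "finite (nbrs_in E' (S - D) D)" using fin by (auto simp: nbrs_in_def)
      then show ?thesis using card_mono[OF _ bigger(1)[OF that]] bigger(2)[OF that] by linarith
    qed
    \<comment> \<open>Otherwise \<open>S - {a, b}\<close> would have no neighbours besides
      \<open>a\<close> and \<open>b\<close>.\<close>
    have notZ: "\<not> Z \<subseteq> {a, b}"
    proof
      assume *: "Z \<subseteq> {a, b}"
      define D where "D = S - {a, b}"
      have D: "D \<subseteq> S - ({a, b} \<union> Z)" "D \<noteq> {}" using * False by (auto simp: D_def)
      have "nbrs_in E' (S - D) D \<subseteq> {a, b}" by (auto simp: D_def nbrs_in_def)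
      then have "card (nbrs_in E' (S - D) D) \<le> card {a, b}" by (intro card_mono) auto
      then show False using sep[OF D] ab by auto
    qed
    have blab: "block_on E' {a, b}" using E' ab by (intro block_on_edge) (auto simp: E'_def)
    have "Z \<subseteq> S" "{a, b} \<subseteq> S" using ab by (auto simp: Z_def nbrs_in_def)
    then obtain S' a' p' b' where S': "{a, b} \<subseteq> S'" "S' \<subseteq> S" "block_on E' S'" "S - S' \<subseteq> Z"
      "ear E' S' a' p' b'" "set p' = S - S'"
      "\<And>a p b. ear E' S' a p b \<Longrightarrow> set p \<subseteq> S - S' \<Longrightarrow> set p = S - S'"
      using maximal_block[OF E'(1) fin(3) block_on_mono[OF S(2) E'(3)] _ blab _ notZ sep] by metis
    note e' = S'(5)[unfolded ear_def]
    \<comment> \<open>A second ear with a single vertex \<open>x\<close> would allow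
      \<open>x\<close> to move to \<open>W\<close>, because the first ear replaces the virtual edge
      in what remains. As \<open>card W + 1 \<le> k\<close>, this contradicts
      \<open>long\<close>.\<close>
    have len: "length p' \<ge> 2"
    proof (rule ccontr)
      assume "\<not> ?thesis"
      then obtain x where "p' = [x]" using e' by (cases p'; cases "tl p'") auto
      then have x: "x \<in> Z" "S = insert x S'" "x \<notin> S'" using S' by auto
      have ear: "ear E S' a p b" using p(1) S' by (auto simp: ear_def)
      have finS': "finite S'" by (rule finite_subset[OF S'(2) fin(3)])
      have bl: "block_on E (S' \<union> set p)"
      proof (cases "card S' \<ge> 3")
        case True
        then show ?thesis using block_on_subdivide_edge[OF symE finS' _ _ ear] S'(3) by (simp add: E'_def)
      next
        case False
        then have "S' = {a, b}" using card_seteq[of S' "{a, b}"] finS' S'(1) ab by auto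
        then have "S - {x} = {a, b}" using x by auto
        then have cab: "conn_on E {a, b}" using S(2) x by (auto simp: block_on_def)
        then have "(a, b) \<in> E"
          using conn_on_crossing[OF cab, of a b "{a}"] ab by auto
        then have "block_on E S'" using block_on_edge[OF symE] ab \<open>S' = {a, b}\<close> by simp
        then show ?thesis by (rule block_on_add_ear[OF symE finS' _ ear])
      qed
      have eq: "V - insert x W = S' \<union> set p" using x S p(2) by auto
      have "card (set p) \<ge> 2" using p(3) e by (simp add: distinct_card)
      moreover have "card (S' \<union> set p) = card S' + card (set p)"
        using ear finS' by (intro card_Un_disjoint) (auto simp: ear_def)
      moreover have "card S' \<ge> 2" using S'(3) by (simp add: block_on_def)
      ultimately have "card (S' \<union> set p) \<ge> 3" by simp
      moreover obtain c where "c \<in> W" "(c, x) \<in> E" using x by (auto simp: Z_def nbrs_in_def)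
      then have "conn_on E (W \<union> {x})"
        by (intro conn_on_edge[OF symE WV(3) conn_on_singleton]) auto
      ultimately have "contractible (insert x W)"
        using bl eq x S WV by (auto simp: contractible_def)
      moreover have "W \<subset> insert x W" using x S by auto
      ultimately have "k < card (insert x W)" by (rule long)
      then show False using W(2) fin by (auto simp: card_insert_if split: if_splits)
    qed
    have cov': "set q = set p'" if "ear E' S' a q b" "set q \<subseteq> set p'" for a q b
      using S'(6,7) that by metis
    have "card (nbrs_in E (V - W) {p' ! i}) \<le> 2" if i: "i < length p'" for i
    proof -
      have "p' ! i \<in> S - {a, b}" using S'(1,6) nth_mem[OF i] by auto
      then have "nbrs_in E (V - W) {p' ! i} \<subseteq> nbrs_in E' (S' \<union> set p') {p' ! i}"
        using inner[of "p' ! i"] H S'(2,6) E'(3) unfolding H_def[symmetric] by (auto simp: nbrs_in_def)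
      also note ear_nbrs[OF E'(1,2) S'(5) len cov' i]
      finally have "card (nbrs_in E (V - W) {p' ! i}) \<le>
        card {if i = 0 then a' else p' ! (i - 1), if Suc i = length p' then b' else p' ! Suc i}"
        by (intro card_mono) auto
      also have "\<dots> \<le> 2" by (simp add: card_insert_if)
      finally show ?thesis .
    qed
    moreover have i: "0 < length p'" "1 < length p'" using len by auto
    moreover have "p' ! 0 \<noteq> p' ! 1"
      using i e' nth_eq_iff_index_eq[of p' 0 1] by simp
    moreover have "p' ! 0 \<in> S" "p' ! 1 \<in> S" "p' ! 0 \<noteq> a"
      using nth_mem[OF i(1)] nth_mem[OF i(2)] S'(1,6) by auto
    ultimately show ?thesis
      using that[of "p' ! 0" "p' ! 1"] by blast
  qed
qed

text \<open>
  All but \<open>k - card W + 1\<close> vertices of the ear are kept, and a vertex \<open>y\<close> of \<open>W\<close> takes the place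
  of the others. The choice of \<open>y\<close> is possible because \<open>3 * e > 2 * card W\<close>: two vertices with \<open>e\<close>
  neighbours in \<open>W\<close> have more than \<open>card W - e\<close> common ones.
\<close>

lemma exchange:
  assumes W: "W \<subseteq> V" "conn_on E W" "card W < k" "2 * k \<le> 3 * e + 1" "card V \<ge> k + 3"
    and S: "S \<subseteq> V - W" "block_on E S"
    and p: "ear E S a p b" "set p = V - W - S" "length p > k - card W"
    and deg: "\<And>x. x \<in> set p \<Longrightarrow> card (nbrs_in E W {x}) \<ge> e"
    and q: "q \<in> S" "q' \<in> S" "q \<noteq> q'" "q \<noteq> a"
      "card (nbrs_in E W {q}) \<ge> e" "card (nbrs_in E W {q'}) \<ge> e"
  shows "\<exists>R. contractible R \<and> card R = k"
proof -
  note e = p(1)[unfolded ear_def]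
  \<comment> \<open>The \<open>+ 1\<close> makes up for \<open>y\<close>, which leaves
    \<open>W\<close>, so that \<open>R\<close> gets exactly \<open>k\<close> vertices.\<close>
  define m where "m = k - card W + 1"
  define i where "i = length p - m"
  have mi: "m \<ge> 2" "i < length p" "length p - i = m" using p W by (auto simp: m_def i_def)
  \<comment> \<open>\<open>x\<close> is the last vertex of the ear that is kept. If none is kept,
    \<open>q'\<close> takes its place and \<open>y\<close> alone becomes an ear from
    \<open>q'\<close> to \<open>q\<close>.\<close>
  define x where "x = (if i = 0 then q' else p ! (i - 1))"
  define z where "z = p ! i"
  have "S \<subseteq> V" using S by auto
  then have fin: "finite W" "finite S" using W finite_sub by auto
  have zp: "z \<in> set p" using mi by (auto simp: z_def)
  have xe: "card (nbrs_in E W {x}) \<ge> e"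
    using q deg[of "p ! (i - 1)"] mi by (auto simp: x_def)
  \<comment> \<open>Any \<open>y\<close> in \<open>Y\<close> joins \<open>x\<close> to
    \<open>q\<close>, and \<open>q\<close> differs from the other end of the new ear.\<close>
  define Y where "Y = nbrs_in E W {x} \<inter> nbrs_in E W {q}"
  have nsub: "nbrs_in E W X \<subseteq> W" for X by (auto simp: nbrs_in_def)
  have fn: "finite (nbrs_in E W X)" for X using finite_subset[OF nsub fin(1)] .
  have e0: "e > 0" using W by simp
  have "card (nbrs_in E W {x}) + card (nbrs_in E W {q}) =
    card (nbrs_in E W {x} \<union> nbrs_in E W {q}) + card Y"
    unfolding Y_def by (intro card_Un_Int fn)
  moreover have "card (nbrs_in E W {x} \<union> nbrs_in E W {q}) \<le> card W"
    using nsub fin by (intro card_mono) auto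
  moreover have "card (nbrs_in E W {z}) \<ge> e" using deg zp by simp
  ultimately have "card Y > card W - card (nbrs_in E W {z})"
    using xe q(5) W(3,4) e0 by linarith
  moreover have "nbrs_in E W {z} \<noteq> {}" using \<open>card (nbrs_in E W {z}) \<ge> e\<close> e0 by auto
  moreover have "z \<notin> W" "Y \<subseteq> W" using zp p(2) by (auto simp: Y_def nbrs_in_def)
  ultimately obtain y where y: "y \<in> Y" "conn_on E (insert z (W - {y}))"
    using conn_on_exchange[OF symE W(2) fin(1)] by metis
  have yW: "y \<in> W" "(x, y) \<in> E" "(q, y) \<in> E" using y by (auto simp: Y_def nbrs_in_def)
  define R where "R = (W - {y}) \<union> set (drop i p)"
  have sp: "successively (\<lambda>u v. (u, v) \<in> E) (take i p)" "successively (\<lambda>u v. (u, v) \<in> E) (drop i p)"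
    using e successively_append_iff[of "\<lambda>u v. (u, v) \<in> E" "take i p" "drop i p"] by auto
  have setp: "set p = set (take i p) \<union> set (drop i p)" "set (take i p) \<inter> set (drop i p) = {}"
    using e set_take_disj_set_drop_if_distinct[of p i i] by (auto simp flip: set_append)
  have zd: "z \<in> set (drop i p)" using mi by (metis Cons_nth_drop_Suc list.set_intros(1) z_def)
  \<comment> \<open>The first removed vertex \<open>z\<close> replaces \<open>y\<close>, and the
    other removed vertices follow \<open>z\<close> along the path.\<close>
  have "conn_on E (insert z (W - {y}) \<union> set (drop i p))"
    using zd mi sp by (intro conn_on_Un[OF symE y(2) conn_on_list[OF symE]]) auto
  moreover have "insert z (W - {y}) \<union> set (drop i p) = R" using zd by (auto simp: R_def)
  ultimately have "conn_on E R" by simp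
  moreover have "card R = k"
  proof -
    have "card R = card (W - {y}) + card (set (drop i p))"
      unfolding R_def using fin setp p(2) by (intro card_Un_disjoint) auto
    also have "card (set (drop i p)) = m" using e mi by (simp add: distinct_card)
    also have "card (W - {y}) = card W - 1" using yW by simp
    finally show ?thesis using W yW fin card_gt_0_iff[of W] by (auto simp: m_def)
  qed
  moreover have RV: "R \<subseteq> V" using W p(2) setp by (auto simp: R_def)
  moreover have "block_on E (V - R)"
  proof -
    have "\<exists>a'. ear E S a' (take i p @ [y]) q"
    proof (cases "i = 0")
      case True
      then have "ear E S q' [y] q" using q yW S symD[OF symE] by (auto simp: ear_def x_def)
      then show ?thesis using True by auto
    next
      case False
      then have "last (take i p) = x" using mi
        by (cases i) (auto simp: x_def take_Suc_conv_app_nth)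
      moreover have "take i p \<noteq> []" "hd (take i p) = hd p" using False mi by auto
      moreover have "y \<notin> set (take i p)" "y \<notin> S" "set (take i p) \<inter> S = {}" using yW p(2) S setp by auto
      ultimately have "ear E S a (take i p @ [y]) q"
        unfolding ear_def using e q sp yW symD[OF symE yW(3)]
        by (simp add: successively_append_iff)
      then show ?thesis by blast
    qed
    then have "block_on E (S \<union> set (take i p @ [y]))"
      using block_on_add_ear[OF symE fin(2) S(2)] by blast
    moreover have "S \<union> set (take i p @ [y]) = V - R"
      using setp p(2) S yW W(1) by (auto simp: R_def)
    ultimately show ?thesis by simp
  qed
  moreover have "card (V - R) \<ge> 3"
    using RV W(5) \<open>card R = k\<close> finite_sub[OF RV] by (simp add: card_Diff_subset)
  ultimately show ?thesis by (auto simp: contractible_def)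
qed

text \<open>The inequality \<open>2 * k \<le> 3 * e + 1\<close> is the one satisfied by the integer
  part \<open>e = (2 * k + 1) div 3\<close>. A maximal contractible set of size below
  \<open>k\<close> would let \<open>exchange\<close> produce one of size \<open>k\<close>.\<close>

lemma contractible_of_card:
  assumes k: "k > 0" "2 * k \<le> 3 * e + 1" "card V \<ge> k + 3"
    and deg: "\<And>v. v \<in> V \<Longrightarrow> card (nbrs_in E V {v}) \<ge> e + 2"
  shows "\<exists>R. contractible R \<and> card R = k"
proof (rule ccontr)
  assume no: "\<not> ?thesis"
  define P where "P R \<longleftrightarrow> contractible R \<and> card R \<le> k" for R
  obtain v where "v \<in> V" using card_V by fastforce
  then have "P {v}" using contractible_singleton k by (simp add: P_def)
  moreover have "\<forall>R. P R \<longrightarrow> card R < Suc k" by (auto simp: P_def)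
  ultimately obtain W where PW: "P W" and max: "\<And>R. P R \<Longrightarrow> card R \<le> card W"
    using ex_has_greatest_nat[of P "{v}" card "Suc k"] by auto
  have W: "contractible W" "card W < k" using PW no by (auto simp: P_def order.strict_iff_order)
  have WV: "W \<subseteq> V" "conn_on E W" using W by (auto simp: contractible_def)
  have long: "k < card R" if "contractible R" "W \<subset> R" for R
  proof (rule ccontr)
    assume "\<not> ?thesis"
    then have "card R \<le> card W" using that by (intro max) (auto simp: P_def)
    moreover have "card W < card R"
      using that finite_sub by (intro psubset_card_mono) (auto simp: contractible_def)
    ultimately show False by simp
  qed
  \<comment> \<open>At most two of the \<open>e + 2\<close> neighbours lie outside
    \<open>W\<close>.\<close>
  have degW: "card (nbrs_in E W {x}) \<ge> e" if "x \<in> V" "card (nbrs_in E (V - W) {x}) \<le> 2" for x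
  proof -
    have "nbrs_in E V {x} = nbrs_in E W {x} \<union> nbrs_in E (V - W) {x}"
      using WV by (auto simp: nbrs_in_def)
    then have "card (nbrs_in E V {x}) \<le> card (nbrs_in E W {x}) + card (nbrs_in E (V - W) {x})"
      by (simp add: card_Un_le)
    then show ?thesis using deg[OF that(1)] that(2) by linarith
  qed
  obtain S a p b where S: "S \<subseteq> V - W" "block_on E S" and p: "ear E S a p b" "set p = V - W - S"
    and cover: "\<And>a' p' b'. ear E S a' p' b' \<Longrightarrow> set p' \<subseteq> set p \<Longrightarrow> set p' = set p"
    and len: "length p > k - card W"
    using first_ear[OF W k(3) long] by metis
  have len2: "length p \<ge> 2" using len W by simp
  obtain q q' where q: "q \<in> S" "q' \<in> S" "q \<noteq> q'" "q \<noteq> a"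
    "card (nbrs_in E (V - W) {q}) \<le> 2" "card (nbrs_in E (V - W) {q'}) \<le> 2"
    by (rule second_ear[OF W long S p len2 cover])
  have "card (nbrs_in E W {x}) \<ge> e" if x: "x \<in> set p" for x
  proof (rule degW)
    obtain i where i: "i < length p" "x = p ! i" using x by (auto simp: in_set_conv_nth)
    have "S \<union> set p = V - W" using S p by auto
    then have "nbrs_in E (V - W) {x} \<subseteq>
      {if i = 0 then a else p ! (i - 1), if Suc i = length p then b else p ! Suc i}"
      using ear_nbrs[OF symE irreflE p(1) len2 cover i(1)] i by simp
    then have "card (nbrs_in E (V - W) {x}) \<le>
      card {if i = 0 then a else p ! (i - 1), if Suc i = length p then b else p ! Suc i}"
      by (intro card_mono) auto
    also have "\<dots> \<le> 2" by (simp add: card_insert_if)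
    finally show "card (nbrs_in E (V - W) {x}) \<le> 2" .
    show "x \<in> V" using x p by auto
  qed
  moreover have "q \<in> V" "q' \<in> V" using q S by auto
  ultimately have "\<exists>R. contractible R \<and> card R = k"
    using exchange[OF WV W(2) k(2,3) S p len _ q(1-4)] degW q by blast
  then show False using no by blast
qed

end

subsection \<open>Translation to the graph library\<close>

context graph
begin

lemma sym_arcs_ends: "sym (arcs_ends G)"
  using sym_arcs by (simp add: symmetric_def)

text \<open>\<open>connected\<close> is strong connectivity of the symmetric closure, which adds no
  adjacencies since \<open>G\<close> is symmetric.\<close>

lemma connected_induce_iff:
  assumes "X \<subseteq> verts G"
  shows "connected (G \<restriction> X) \<longleftrightarrow> conn_on (arcs_ends G) X"
proof -
  let ?A = "{(u, v). (u, v) \<in> arcs_ends G \<and> u \<in> X \<and> v \<in> X}"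
  have ends: "parcs (mk_symmetric (G \<restriction> X)) = ?A"
    using symD[OF sym_arcs_ends] by (auto simp: parcs_mk_symmetric arcs_ends_conv)
  have "rtrancl_on X ?A = rtrancl_on X (arcs_ends G)"
  proof (intro subset_antisym subrelI)
    fix u v assume "(u, v) \<in> rtrancl_on X (arcs_ends G)"
    then show "(u, v) \<in> rtrancl_on X ?A"
      by (induction rule: rtrancl_on_induct) (auto intro: rtrancl_on_into_rtrancl_on)
  next
    fix u v assume "(u, v) \<in> rtrancl_on X ?A"
    then show "(u, v) \<in> rtrancl_on X (arcs_ends G)"
      by (rule rtrancl_on_mono[rotated 2]) auto
  qed
  then show ?thesis
    by (simp add: connected_def strongly_connected_def reachable_def conn_on_def ends)
qed

lemma connected_del_verts_iff:
  "connected (del_verts G S) \<longleftrightarrow> conn_on (arcs_ends G) (verts G - S)"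
  unfolding del_verts_def by (rule connected_induce_iff) auto

lemma vertex_connected_2_del_verts:
  assumes "R \<subseteq> verts G" "card (verts G - R) \<ge> 3" "block_on (arcs_ends G) (verts G - R)"
  shows "vertex_connected 2 (del_verts G R)"
proof -
  let ?X = "verts G - R"
  have "connected (del_verts (del_verts G R) S)" if S: "S \<subseteq> ?X" "card S < 2" for S
  proof -
    have eq: "del_verts (del_verts G R) S = G \<restriction> (?X - S)"
      by (auto simp: del_verts_def induce_subgraph_def)
    have "finite S" using S(1) finite_verts finite_subset by blast
    then have "S = {} \<or> (\<exists>v. S = {v})"
      using S(2) by (auto simp: less_2_cases_iff card_1_singleton_iff)
    then have "conn_on (arcs_ends G) (?X - S)"
      using assms(3) S(1) by (auto simp: block_on_def)
    then show ?thesis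
      unfolding eq by (subst connected_induce_iff) auto
  qed
  then show ?thesis
    using assms(2) by (auto simp: vertex_connected_def del_verts_def)
qed

text \<open>Without parallel arcs, \<open>head G\<close> is injective on the arcs that leave
  \<open>v\<close>.\<close>

lemma out_degree_eq_card_nbrs:
  assumes "v \<in> verts G"
  shows "out_degree G v = card (nbrs_in (arcs_ends G) (verts G) {v})"
proof -
  have "inj_on (head G) (out_arcs G v)"
    using no_multi_arcs by (auto simp: inj_on_def arc_to_ends_def)
  moreover have "head G ` out_arcs G v = nbrs_in (arcs_ends G) (verts G) {v}"
    by (auto simp: nbrs_in_def arcs_ends_conv)
  ultimately show ?thesis by (metis card_image out_degree_def)
qed

end

theorem theorem3:
  fixes G :: "('a, 'b) pre_digraph" and k :: nat
  assumes "k \<ge> 5"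
    and "graph G"
    and "vertex_connected 3 G"
    and "card (verts G) \<ge> k + 3"
    and "min_degree G \<ge> (2 * k + 1) div 3 + 2"
  shows "\<exists>R. k_contractible_set k G R"
proof -
  interpret graph G by fact
  interpret three_connected "arcs_ends G" "verts G"
  proof
    show "sym (arcs_ends G)" by (rule sym_arcs_ends)
    show "irrefl (arcs_ends G)" using adj_not_same by (auto simp: irrefl_def)
    show "card (verts G) > 3" using assms(3) by (simp add: vertex_connected_def)
    show "conn_on (arcs_ends G) (verts G - S)" if "S \<subseteq> verts G" "card S < 3" for S
      using assms(3) that by (simp add: vertex_connected_def connected_del_verts_iff)
  qed auto
  have "card (nbrs_in (arcs_ends G) (verts G) {v}) \<ge> (2 * k + 1) div 3 + 2" if "v \<in> verts G" for v
  proof -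
    have "min_degree G \<le> out_degree G v"
      unfolding min_degree_def using that by (intro Min_le) auto
    then show ?thesis using assms(5) that by (simp add: out_degree_eq_card_nbrs)
  qed
  moreover have "2 * k \<le> 3 * ((2 * k + 1) div 3) + 1" by presburger
  ultimately obtain R where "contractible R" "card R = k"
    using contractible_of_card[of k "(2 * k + 1) div 3"] assms(1,4) by auto
  then show ?thesis
    using vertex_connected_2_del_verts connected_induce_iff
    by (auto simp: contractible_def k_contractible_set_def contractible_set_def)
qed

end
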